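(* Let $k$ be a field and $A=\bigoplus_{n\in\mathbb{Z}_+}A^n$ a $\mathbb{Z}_+$-graded commutative $k$-algebra equipped with a derivation $\tau$ of degree $+1$. Assume that $A$ is generated by $A^0$ as a differential algebra (i.e. by $A^0$ and the iterates $\tau^jA^0$) and that $A^0$ is a $k$-algebra of finite type. Then $H_{-1}(K^A_\bullet,\iota_\tau)=0$ if and only if the canonical morphism of differential algebras $JA^0\to A$ is an isomorphism.
   Context: $\Omega_{A/k}$ is the $A$-module of Kähler differentials. $K^A_\bullet=\operatorname{Sym}_A(\Omega_{A/k}[1])=\bigoplus_{n\ge0}\Lambda^n_A\Omega_{A/k}$, with $\Lambda^n_A\Omega_{A/k}$ placed in homological degree $-n$. The contraction $\iota_\tau:\Omega_{A/k}\to A$, $f\,dg\mapsto f\tau(g)$, extends uniquely to a differential (odd derivation) $\iota_\tau$ on $K^A_\bullet$, $\iota_\tau(\omega_1\wedge\cdots\wedge\omega_n)=\sum_i(-1)^{i-1}\iota_\tau(\omega_i)\,\omega_1\wedge\cdots\widehat{\omega_i}\cdots\wedge\omega_n$. Thus $H_{-1}(K^A_\bullet,\iota_\tau)=\ker(\iota_\tau:\Omega_{A/k}\to A)/\iota_\tau(\Lambda^2_A\Omega_{A/k})$. $JA^0$ denotes the coordinate ring of the arc space of $\operatorname{Spec}A^0$: the differential $k$-algebra freely generated by $A^0$ (with universal derivation $\partial$), i.e. for every $k$-algebra $R$ with derivation $\tau$ and algebra map $A^0\to R$ there is a unique differential algebra map $(JA^0,\partial)\to(R,\tau)$ extending it.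 The canonical morphism $JA^0\to A$ is the one extending the inclusion $A^0\subset A$; it is surjective under the hypotheses. *)

theory Defs
  imports Main
begin

definition is_k_algebra :: "('k::field \<Rightarrow> 'a::comm_ring_1) \<Rightarrow> bool" where
  "is_k_algebra \<phi> \<longleftrightarrow> \<phi> 1 = 1 \<and> (\<forall>c d. \<phi> (c + d) = \<phi> c + \<phi> d) \<and> (\<forall>c d. \<phi> (c * d) = \<phi> c * \<phi> d)"

text \<open>k-linear derivation of A (k-linearity = kills the image of k, given Leibniz).\<close>
definition is_k_derivation :: "('k::field \<Rightarrow> 'a::comm_ring_1) \<Rightarrow> ('a \<Rightarrow> 'a) \<Rightarrow> bool" where
  "is_k_derivation \<phi> \<tau> \<longleftrightarrow> (\<forall>a b. \<tau> (a + b) = \<tau> a + \<tau> b) \<and> (\<forall>a b. \<tau> (a * b) = a * \<tau> b + b * \<tau> a)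
     \<and> (\<forall>c. \<tau> (\<phi> c) = 0)"

definition is_graded :: "('k::field \<Rightarrow> 'a::comm_ring_1) \<Rightarrow> (nat \<Rightarrow> 'a set) \<Rightarrow> bool" where
  "is_graded \<phi> Agr \<longleftrightarrow>
     (\<forall>n. 0 \<in> Agr n \<and> (\<forall>x\<in>Agr n. \<forall>y\<in>Agr n. x + y \<in> Agr n) \<and> (\<forall>c. \<forall>x\<in>Agr n. \<phi> c * x \<in> Agr n))
   \<and> (\<forall>m n. \<forall>x\<in>Agr m. \<forall>y\<in>Agr n. x * y \<in> Agr (m + n))
   \<and> 1 \<in> Agr 0
   \<and> (\<forall>a. \<exists>f. (\<forall>n. f n \<in> Agr n) \<and> finite {n. f n \<noteq> 0} \<and> a = (\<Sum>n\<in>{n. f n \<noteq> 0}. f n))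
   \<and> (\<forall>f. (\<forall>n. f n \<in> Agr n) \<and> finite {n. f n \<noteq> 0} \<and> (\<Sum>n\<in>{n. f n \<noteq> 0}. f n) = 0 \<longrightarrow> (\<forall>n. f n = 0))"

definition degree_one :: "(nat \<Rightarrow> 'a set) \<Rightarrow> ('a \<Rightarrow> 'a) \<Rightarrow> bool" where
  "degree_one Agr \<tau> \<longleftrightarrow> (\<forall>n. \<forall>x\<in>Agr n. \<tau> x \<in> Agr (Suc n))"

inductive_set alg_closure :: "('k::field \<Rightarrow> 'a::comm_ring_1) \<Rightarrow> 'a set \<Rightarrow> 'a set"
  for \<phi> :: "'k \<Rightarrow> 'a" and S :: "'a set" where
  gen: "x \<in> S \<Longrightarrow> x \<in> alg_closure \<phi> S"
| scal: "\<phi> c \<in> alg_closure \<phi> S"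
| add: "x \<in> alg_closure \<phi> S \<Longrightarrow> y \<in> alg_closure \<phi> S \<Longrightarrow> x + y \<in> alg_closure \<phi> S"
| mult: "x \<in> alg_closure \<phi> S \<Longrightarrow> y \<in> alg_closure \<phi> S \<Longrightarrow> x * y \<in> alg_closure \<phi> S"

definition finite_type :: "('k::field \<Rightarrow> 'a::comm_ring_1) \<Rightarrow> 'a set \<Rightarrow> bool" where
  "finite_type \<phi> B \<longleftrightarrow> (\<exists>S. finite S \<and> S \<subseteq> B \<and> alg_closure \<phi> S = B)"

definition diff_generated :: "('k::field \<Rightarrow> 'a::comm_ring_1) \<Rightarrow> ('a \<Rightarrow> 'a) \<Rightarrow> 'a set \<Rightarrow> bool" where
  "diff_generated \<phi> \<tau> B \<longleftrightarrow> alg_closure \<phi> (\<Union>j. (\<tau> ^^ j) ` B) = UNIV"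

text \<open>Omega_{A/k} is presented as the free A-module on symbols dg (g in A), elements
  being finitely supported functions 'a => 'a, modulo the A-submodule generated by the
  relations d(g+h)-dg-dh, d(gh)-g dh-h dg, d(phi c).\<close>

definition fin_supp :: "('a \<Rightarrow> 'b::zero) \<Rightarrow> bool" where
  "fin_supp x \<longleftrightarrow> finite {g. x g \<noteq> 0}"

definition dsym :: "'a \<Rightarrow> 'a \<Rightarrow> 'a::comm_ring_1" where
  "dsym g = (\<lambda>h. if h = g then 1 else 0)"

inductive_set amod_span :: "('a \<Rightarrow> 'a::comm_ring_1) set \<Rightarrow> ('a \<Rightarrow> 'a) set"
  for S :: "('a \<Rightarrow> 'a) set" where
  zero: "(\<lambda>_. 0) \<in> amod_span S"
| smul: "s \<in> S \<Longrightarrow> (\<lambda>h. a * s h) \<in> amod_span S"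
| add: "x \<in> amod_span S \<Longrightarrow> y \<in> amod_span S \<Longrightarrow> (\<lambda>h. x h + y h) \<in> amod_span S"

definition kaehler_relations :: "('k::field \<Rightarrow> 'a::comm_ring_1) \<Rightarrow> ('a \<Rightarrow> 'a) set" where
  "kaehler_relations \<phi> =
     {(\<lambda>h. dsym (g1 + g2) h - dsym g1 h - dsym g2 h) | g1 g2. True}
   \<union> {(\<lambda>h. dsym (g1 * g2) h - g1 * dsym g2 h - g2 * dsym g1 h) | g1 g2. True}
   \<union> {dsym (\<phi> c) | c. True}"

definition contr :: "('a \<Rightarrow> 'a) \<Rightarrow> ('a \<Rightarrow> 'a::comm_ring_1) \<Rightarrow> 'a" where
  "contr \<tau> x = (\<Sum>g\<in>{g. x g \<noteq> 0}. x g * \<tau> g)"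

text \<open>Image of iota_tau : Lambda^2 Omega -> Omega, spanned over A by
  iota_tau(dg /\ dh) = tau(g) dh - tau(h) dg.\<close>
definition wedge2_image :: "('a \<Rightarrow> 'a::comm_ring_1) \<Rightarrow> ('a \<Rightarrow> 'a) set" where
  "wedge2_image \<tau> = {(\<lambda>u. \<tau> g * dsym h u - \<tau> h * dsym g u) | g h. True}"

text \<open>H_{-1}(K^A, iota_tau) = ker(iota_tau : Omega -> A) / iota_tau(Lambda^2 Omega) vanishes.\<close>
definition H_minus1_vanishes :: "('k::field \<Rightarrow> 'a::comm_ring_1) \<Rightarrow> ('a \<Rightarrow> 'a) \<Rightarrow> bool" where
  "H_minus1_vanishes \<phi> \<tau> \<longleftrightarrow>
     (\<forall>x. fin_supp x \<and> contr \<tau> x = 0 \<longrightarrow> x \<in> amod_span (kaehler_relations \<phi> \<union> wedge2_image \<tau>))"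

section \<open>Arc space JA^0: the free differential k-algebra on the k-algebra A^0,
  constructed by generators and relations\<close>

datatype ('a, 'k) jterm = JVar 'a | JConst 'k | JAdd "('a, 'k) jterm" "('a, 'k) jterm"
  | JMul "('a, 'k) jterm" "('a, 'k) jterm" | JNeg "('a, 'k) jterm" | JDer "('a, 'k) jterm"

fun jwf :: "'a set \<Rightarrow> ('a, 'k) jterm \<Rightarrow> bool" where
  "jwf B (JVar a) = (a \<in> B)"
| "jwf B (JConst c) = True"
| "jwf B (JAdd s t) = (jwf B s \<and> jwf B t)"
| "jwf B (JMul s t) = (jwf B s \<and> jwf B t)"
| "jwf B (JNeg s) = jwf B s"
| "jwf B (JDer s) = jwf B s"

inductive jcong :: "('a::comm_ring_1 \<Rightarrow> 'a) \<Rightarrow> ('k::field \<Rightarrow> 'a) \<Rightarrow> 'a set \<Rightarrow> ('a, 'k) jterm \<Rightarrow> ('a, 'k) jterm \<Rightarrow> bool"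
  for \<tau> :: "'a \<Rightarrow> 'a" and \<phi> :: "'k \<Rightarrow> 'a" and B :: "'a set" where
  refl: "jwf B s \<Longrightarrow> jcong \<tau> \<phi> B s s"
| sym: "jcong \<tau> \<phi> B s t \<Longrightarrow> jcong \<tau> \<phi> B t s"
| trans: "jcong \<tau> \<phi> B s t \<Longrightarrow> jcong \<tau> \<phi> B t u \<Longrightarrow> jcong \<tau> \<phi> B s u"
| cAdd: "jcong \<tau> \<phi> B s s' \<Longrightarrow> jcong \<tau> \<phi> B t t' \<Longrightarrow> jcong \<tau> \<phi> B (JAdd s t) (JAdd s' t')"
| cMul: "jcong \<tau> \<phi> B s s' \<Longrightarrow> jcong \<tau> \<phi> B t t' \<Longrightarrow> jcong \<tau> \<phi> B (JMul s t) (JMul s' t')"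
| cNeg: "jcong \<tau> \<phi> B s s' \<Longrightarrow> jcong \<tau> \<phi> B (JNeg s) (JNeg s')"
| cDer: "jcong \<tau> \<phi> B s s' \<Longrightarrow> jcong \<tau> \<phi> B (JDer s) (JDer s')"
| add_assoc: "jwf B s \<Longrightarrow> jwf B t \<Longrightarrow> jwf B u \<Longrightarrow> jcong \<tau> \<phi> B (JAdd (JAdd s t) u) (JAdd s (JAdd t u))"
| add_comm: "jwf B s \<Longrightarrow> jwf B t \<Longrightarrow> jcong \<tau> \<phi> B (JAdd s t) (JAdd t s)"
| add_zero: "jwf B s \<Longrightarrow> jcong \<tau> \<phi> B (JAdd s (JConst 0)) s"
| add_neg: "jwf B s \<Longrightarrow> jcong \<tau> \<phi> B (JAdd s (JNeg s)) (JConst 0)"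
| mul_assoc: "jwf B s \<Longrightarrow> jwf B t \<Longrightarrow> jwf B u \<Longrightarrow> jcong \<tau> \<phi> B (JMul (JMul s t) u) (JMul s (JMul t u))"
| mul_comm: "jwf B s \<Longrightarrow> jwf B t \<Longrightarrow> jcong \<tau> \<phi> B (JMul s t) (JMul t s)"
| mul_one: "jwf B s \<Longrightarrow> jcong \<tau> \<phi> B (JMul s (JConst 1)) s"
| distrib: "jwf B s \<Longrightarrow> jwf B t \<Longrightarrow> jwf B u \<Longrightarrow> jcong \<tau> \<phi> B (JMul s (JAdd t u)) (JAdd (JMul s t) (JMul s u))"
| const_add: "jcong \<tau> \<phi> B (JConst (c + d)) (JAdd (JConst c) (JConst d))"
| const_mul: "jcong \<tau> \<phi> B (JConst (c * d)) (JMul (JConst c) (JConst d))"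
| der_add: "jwf B s \<Longrightarrow> jwf B t \<Longrightarrow> jcong \<tau> \<phi> B (JDer (JAdd s t)) (JAdd (JDer s) (JDer t))"
| der_mul: "jwf B s \<Longrightarrow> jwf B t \<Longrightarrow> jcong \<tau> \<phi> B (JDer (JMul s t)) (JAdd (JMul (JDer s) t) (JMul s (JDer t)))"
| der_const: "jcong \<tau> \<phi> B (JDer (JConst c)) (JConst 0)"
| var_add: "a \<in> B \<Longrightarrow> b \<in> B \<Longrightarrow> jcong \<tau> \<phi> B (JVar (a + b)) (JAdd (JVar a) (JVar b))"
| var_mul: "a \<in> B \<Longrightarrow> b \<in> B \<Longrightarrow> jcong \<tau> \<phi> B (JVar (a * b)) (JMul (JVar a) (JVar b))"
| var_const: "\<phi> c \<in> B \<Longrightarrow> jcong \<tau> \<phi> B (JVar (\<phi> c)) (JConst c)"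

fun jeval :: "('a::comm_ring_1 \<Rightarrow> 'a) \<Rightarrow> ('k \<Rightarrow> 'a) \<Rightarrow> ('a, 'k) jterm \<Rightarrow> 'a" where
  "jeval \<tau> \<phi> (JVar a) = a"
| "jeval \<tau> \<phi> (JConst c) = \<phi> c"
| "jeval \<tau> \<phi> (JAdd s t) = jeval \<tau> \<phi> s + jeval \<tau> \<phi> t"
| "jeval \<tau> \<phi> (JMul s t) = jeval \<tau> \<phi> s * jeval \<tau> \<phi> t"
| "jeval \<tau> \<phi> (JNeg s) = - jeval \<tau> \<phi> s"
| "jeval \<tau> \<phi> (JDer s) = \<tau> (jeval \<tau> \<phi> s)"

text \<open>The canonical morphism JA^0 -> A is an isomorphism: the induced map on the
  quotient (well-formed terms modulo jcong) is injective and surjective.\<close>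
definition canonical_iso :: "('a::comm_ring_1 \<Rightarrow> 'a) \<Rightarrow> ('k::field \<Rightarrow> 'a) \<Rightarrow> 'a set \<Rightarrow> bool" where
  "canonical_iso \<tau> \<phi> B \<longleftrightarrow>
     (\<forall>s t. jwf B s \<longrightarrow> jwf B t \<longrightarrow> (jeval \<tau> \<phi> s = jeval \<tau> \<phi> t \<longleftrightarrow> jcong \<tau> \<phi> B s t))
   \<and> (\<forall>a. \<exists>t. jwf B t \<and> jeval \<tau> \<phi> t = a)"

end

theory Submission
  imports Defs
begin

text \<open>Let \<open>M\<close> be the quotient of \<open>\<Omega>\<close> by \<open>\<iota>\<^sub>\<tau>(\<Lambda>\<^sup>2 \<Omega>)\<close>; vanishing of \<open>H\<^sub>-\<^sub>1\<close> means that \<open>\<iota>\<^sub>\<tau> : M \<rightarrow> A\<close> is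
  injective.

  In \<open>M\<close> the identity \<open>\<iota>(x) y = \<iota>(y) x\<close> holds, so \<open>A\<^sup>0 \<oplus> M\<close> is a commutative ring with
  \<open>(a, x) (b, y) = (a b, a y + b x + \<iota>(x) y)\<close> and a differential algebra over \<open>A\<close> with derivation
  \<open>(a, x) \<mapsto> (0, d (a + \<iota>(x)))\<close>. If \<open>A\<close> is the arc algebra, its universal property yields a
  differential section \<open>A \<rightarrow> A\<^sup>0 \<oplus> M\<close>, which restricts to a left inverse of \<open>\<iota>\<^sub>\<tau>\<close>.

  Conversely, one shows by induction on the degree that the arc algebra has no kernel over \<open>A\<close>. An
  element of degree \<open>n + 1\<close> is a sum of terms \<open>y \<partial>z\<close> with \<open>deg y + deg z = n\<close>. If it maps to \<open>0\<close>, the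
  form \<open>\<Sum> y dz\<close> over \<open>A\<close> vanishes in \<open>M\<close>. All relations of \<open>M\<close> in this degree only involve elements
  of degree at most \<open>n\<close>, so they lift to the arc algebra, and contraction gives \<open>\<Sum> y \<partial>z = 0\<close>.\<close>

subsection \<open>Arc algebras as a type\<close>

type_synonym ('a, 'k) jparam = "('a \<Rightarrow> 'a) \<times> ('k \<Rightarrow> 'a) \<times> 'a set"

text \<open>\<open>jcong\<close> can relate ill-formed terms: \<open>var_add\<close> concerns
  \<open>JVar (a + b)\<close> even when \<open>a + b\<close> lies outside \<open>B\<close>. The
  parameters are arbitrary here, so well-formedness of both sides is imposed explicitly.\<close>

definition jequiv ::
    "('a::comm_ring_1, 'k::field) jparam \<Rightarrow> ('a, 'k) jterm \<Rightarrow> ('a, 'k) jterm \<Rightarrow> bool" where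
  "jequiv p s t \<longleftrightarrow> (case p of (\<tau>, \<phi>, B) \<Rightarrow> jwf B s \<and> jwf B t \<and> jcong \<tau> \<phi> B s t)"

lemma jequiv_iff: "jequiv (\<tau>, \<phi>, B) s t \<longleftrightarrow> jwf B s \<and> jwf B t \<and> jcong \<tau> \<phi> B s t"
  by (simp add: jequiv_def)

lemma jequiv_sym: "jequiv p s t \<Longrightarrow> jequiv p t s"
  by (cases p) (auto simp: jequiv_iff intro: jcong.sym)

lemma jequiv_trans: "jequiv p s t \<Longrightarrow> jequiv p t u \<Longrightarrow> jequiv p s u"
  by (cases p) (auto simp: jequiv_iff intro: jcong.trans)

lemma jequiv_const: "jequiv p (JConst c) (JConst c)"
  by (cases p) (auto simp: jequiv_iff intro: jcong.refl)

lemma jequiv_cong: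
  assumes "jequiv p s s'"
  shows "jequiv p (JNeg s) (JNeg s')" "jequiv p (JDer s) (JDer s')"
    "jequiv p t t' \<Longrightarrow> jequiv p (JAdd s t) (JAdd s' t')"
    "jequiv p t t' \<Longrightarrow> jequiv p (JMul s t) (JMul s' t')"
  using assms by (cases p; auto simp: jequiv_iff intro: jcong.intros)+

lemma jequiv_ring:
  assumes s: "jequiv p s s"
  shows "jequiv p (JAdd (JConst 0) s) s"
    "jequiv p (JAdd (JNeg s) s) (JConst 0)"
    "jequiv p t t \<Longrightarrow> jequiv p (JAdd s t) (JAdd t s)"
    "jequiv p t t \<Longrightarrow> jequiv p (JMul s t) (JMul t s)"
    "jequiv p t t \<Longrightarrow> jequiv p (JDer (JAdd s t)) (JAdd (JDer s) (JDer t))"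
    "jequiv p t t \<Longrightarrow> jequiv p (JDer (JMul s t)) (JAdd (JMul (JDer s) t) (JMul s (JDer t)))"
    "jequiv p t t \<Longrightarrow> jequiv p u u \<Longrightarrow> jequiv p (JAdd (JAdd s t) u) (JAdd s (JAdd t u))"
    "jequiv p t t \<Longrightarrow> jequiv p u u \<Longrightarrow> jequiv p (JMul (JMul s t) u) (JMul s (JMul t u))"
    "jequiv p t t \<Longrightarrow> jequiv p u u \<Longrightarrow> jequiv p (JMul (JAdd s t) u) (JAdd (JMul s u) (JMul t u))"
proof -
  show "jequiv p (JAdd s t) (JAdd t s)" "jequiv p (JMul s t) (JMul t s)"
    "jequiv p (JDer (JAdd s t)) (JAdd (JDer s) (JDer t))"
    "jequiv p (JDer (JMul s t)) (JAdd (JMul (JDer s) t) (JMul s (JDer t)))" if "jequiv p t t"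
    using s that by (cases p; auto simp: jequiv_iff intro: jcong.intros)+
  show "jequiv p (JAdd (JAdd s t) u) (JAdd s (JAdd t u))"
    "jequiv p (JMul (JMul s t) u) (JMul s (JMul t u))" if "jequiv p t t" "jequiv p u u"
    using s that by (cases p; auto simp: jequiv_iff intro: jcong.intros)+
  have "jequiv p (JAdd (JConst 0) s) (JAdd s (JConst 0))" "jequiv p (JAdd s (JConst 0)) s"
    using s by (cases p; auto simp: jequiv_iff intro: jcong.intros)+
  then show "jequiv p (JAdd (JConst 0) s) s" by (rule jequiv_trans)
  have "jequiv p (JAdd (JNeg s) s) (JAdd s (JNeg s))" "jequiv p (JAdd s (JNeg s)) (JConst 0)"
    using s by (cases p; auto simp: jequiv_iff intro: jcong.intros)+
  then show "jequiv p (JAdd (JNeg s) s) (JConst 0)" by (rule jequiv_trans)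
  show "jequiv p (JMul (JAdd s t) u) (JAdd (JMul s u) (JMul t u))" if "jequiv p t t" "jequiv p u u"
  proof -
    have "jequiv p (JMul (JAdd s t) u) (JMul u (JAdd s t))"
      and "jequiv p (JMul u (JAdd s t)) (JAdd (JMul u s) (JMul u t))"
      and "jequiv p (JMul u s) (JMul s u)" "jequiv p (JMul u t) (JMul t u)"
      using s that by (cases p; auto simp: jequiv_iff intro: jcong.intros)+
    then show ?thesis by (meson jequiv_trans jequiv_cong)
  qed
qed

text \<open>Outside the factor \<open>p\<close>, a value of \<open>arc p\<close> is constantly
  \<open>JConst 0\<close>; these equivalences make \<open>arc p\<close> compatible with the
  operations there.\<close>

lemma jequiv_zero:
  "jequiv p (JConst 0) (JAdd (JConst 0) (JConst 0))"
  "jequiv p (JConst 0) (JMul (JConst 0) (JConst 0))"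
  "jequiv p (JConst 0) (JNeg (JConst 0))"
  "jequiv p (JConst 0) (JDer (JConst 0))"
proof -
  show "jequiv p (JConst 0) (JAdd (JConst 0) (JConst 0))"
    using jcong.const_add[of _ _ _ 0 0] by (cases p) (simp add: jequiv_iff)
  show "jequiv p (JConst 0) (JMul (JConst 0) (JConst 0))"
    using jcong.const_mul[of _ _ _ 0 0] by (cases p) (simp add: jequiv_iff)
  show "jequiv p (JConst 0) (JDer (JConst 0))"
    by (cases p) (simp add: jequiv_iff jcong.sym jcong.der_const)
  have n: "jequiv p (JNeg (JConst 0)) (JNeg (JConst 0))"
    by (intro jequiv_cong jequiv_const)
  have "jequiv p (JAdd (JConst 0) (JNeg (JConst 0))) (JConst 0)"
    by (cases p) (simp add: jequiv_iff jcong.add_neg)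
  then show "jequiv p (JConst 0) (JNeg (JConst 0))"
    using jequiv_ring(1)[OF n] by (meson jequiv_sym jequiv_trans)
qed

definition jequivs ::
    "(('a::comm_ring_1, 'k::field) jparam \<Rightarrow> ('a, 'k) jterm) \<Rightarrow> (('a, 'k) jparam \<Rightarrow> ('a, 'k) jterm) \<Rightarrow> bool"
  where "jequivs f g \<longleftrightarrow> (\<forall>p. jequiv p (f p) (g p))"

text \<open>A quotient type cannot depend on the term parameters \<open>\<tau>\<close>, \<open>\<phi>\<close>, \<open>B\<close>, so we form the product of
  the arc algebras over all parameters. The map \<open>arc p\<close> identifies the arc algebra of the
  parameters \<open>p\<close> with the corresponding factor.\<close>

quotient_type (overloaded) ('a, 'k) arcs =
  "('a::comm_ring_1, 'k::field) jparam \<Rightarrow> ('a, 'k) jterm" / partial: jequivs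
proof (rule part_equivpI)
  show "\<exists>f. jequivs f f"
    by (rule exI[of _ "\<lambda>_. JConst 0"]) (simp add: jequivs_def jequiv_const)
  show "symp jequivs"
    unfolding symp_def jequivs_def by (metis jequiv_sym)
  show "transp jequivs"
    unfolding transp_def jequivs_def by (metis jequiv_trans)
qed

lemma abs_arcs_eqI: "jequivs f g \<Longrightarrow> abs_arcs f = abs_arcs g"
  by (rule Quotient_rel_abs[OF Quotient_arcs])

lemma arcs_cases:
  obtains f where "x = abs_arcs f" "jequivs f f"
  using Quotient_abs_rep[OF Quotient_arcs] Quotient_rep_reflp[OF Quotient_arcs] by metis

lemma jequivs_cong:
  "jequivs f f' \<Longrightarrow> jequivs (\<lambda>p. JNeg (f p)) (\<lambda>p. JNeg (f' p))"
  "jequivs f f' \<Longrightarrow> jequivs (\<lambda>p. JDer (f p)) (\<lambda>p. JDer (f' p))"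
  "jequivs f f' \<Longrightarrow> jequivs g g' \<Longrightarrow> jequivs (\<lambda>p. JAdd (f p) (g p)) (\<lambda>p. JAdd (f' p) (g' p))"
  "jequivs f f' \<Longrightarrow> jequivs g g' \<Longrightarrow> jequivs (\<lambda>p. JMul (f p) (g p)) (\<lambda>p. JMul (f' p) (g' p))"
  by (simp_all add: jequivs_def jequiv_cong)

text \<open>Non-unital by design: the unit \<open>arc p (JConst 1)\<close> of a single factor
  differs in general from the unit of the whole product.\<close>

instantiation arcs :: (comm_ring_1, field) comm_ring
begin

lift_definition zero_arcs :: "('a, 'b) arcs" is "\<lambda>_. JConst 0"
  by (simp add: jequivs_def jequiv_const)
lift_definition plus_arcs :: "('a, 'b) arcs \<Rightarrow> ('a, 'b) arcs \<Rightarrow> ('a, 'b) arcs"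
  is "\<lambda>f g p. JAdd (f p) (g p)" by (rule jequivs_cong)
lift_definition times_arcs :: "('a, 'b) arcs \<Rightarrow> ('a, 'b) arcs \<Rightarrow> ('a, 'b) arcs"
  is "\<lambda>f g p. JMul (f p) (g p)" by (rule jequivs_cong)
lift_definition uminus_arcs :: "('a, 'b) arcs \<Rightarrow> ('a, 'b) arcs"
  is "\<lambda>f p. JNeg (f p)" by (rule jequivs_cong)
definition minus_arcs :: "('a, 'b) arcs \<Rightarrow> ('a, 'b) arcs \<Rightarrow> ('a, 'b) arcs"
  where "minus_arcs x y = x + - y"

instance
proof
  fix x y z :: "('a, 'b) arcs"
  obtain f where f: "x = abs_arcs f" "jequivs f f" by (rule arcs_cases)
  obtain g where g: "y = abs_arcs g" "jequivs g g" by (rule arcs_cases)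
  obtain h where h: "z = abs_arcs h" "jequivs h h" by (rule arcs_cases)
  note abs_eqs = zero_arcs_def plus_arcs.abs_eq times_arcs.abs_eq uminus_arcs.abs_eq jequivs_cong
  note refl = f(2) g(2) h(2)
  have c: "jequivs (\<lambda>_. JConst 0) (\<lambda>_. JConst 0 :: ('a, 'b) jterm)"
    by (simp add: jequivs_def jequiv_const)
  show "x + y + z = x + (y + z)" "x + y = y + x" "0 + x = x" "- x + x = 0"
    "x * y * z = x * (y * z)" "x * y = y * x" "(x + y) * z = x * z + y * z"
    unfolding f(1) g(1) h(1)
    by (simp add: abs_eqs refl c, rule abs_arcs_eqI,
        simp add: jequiv_ring refl[unfolded jequivs_def] jequivs_def del: split_paired_All)+
  show "x - y = x + - y"
    by (simp add: minus_arcs_def)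
qed

end

lift_definition arc_der :: "('a::comm_ring_1, 'k::field) arcs \<Rightarrow> ('a, 'k) arcs"
  is "\<lambda>f p. JDer (f p)" by (rule jequivs_cong)

lemma arc_der_add: "arc_der (x + y) = arc_der x + arc_der y"
  and arc_der_mult: "arc_der (x * y) = arc_der x * y + x * arc_der y"
proof -
  obtain f where f: "x = abs_arcs f" "jequivs f f" by (rule arcs_cases)
  obtain g where g: "y = abs_arcs g" "jequivs g g" by (rule arcs_cases)
  note abs_eqs = plus_arcs.abs_eq times_arcs.abs_eq arc_der.abs_eq jequivs_cong
  note refl = f(2) g(2)
  show "arc_der (x + y) = arc_der x + arc_der y" "arc_der (x * y) = arc_der x * y + x * arc_der y"
    unfolding f(1) g(1)
    by (simp add: abs_eqs refl, rule abs_arcs_eqI,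
        simp add: jequiv_ring refl[unfolded jequivs_def] jequivs_def del: split_paired_All)+
qed

definition arc ::
    "('a::comm_ring_1, 'k::field) jparam \<Rightarrow> ('a, 'k) jterm \<Rightarrow> ('a, 'k) arcs"
  where "arc p t = abs_arcs (\<lambda>q. if q = p then t else JConst 0)"

lemma jequivs_arc:
  "jequivs (\<lambda>q. if q = p then s else JConst 0) (\<lambda>q. if q = p then t else JConst 0) \<longleftrightarrow> jequiv p s t"
proof
  show "jequiv p s t"
    if "jequivs (\<lambda>q. if q = p then s else JConst 0) (\<lambda>q. if q = p then t else JConst 0)"
    using that[unfolded jequivs_def, rule_format, of p] by simp
qed (simp add: jequivs_def jequiv_const del: split_paired_All)

text \<open>All other factors carry \<open>JConst 0\<close> on both sides, so equality in the
  product is decided in one factor, where it is \<open>jcong\<close>.\<close>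

lemma arc_eq_iff:
  assumes "jwf B s" "jwf B t"
  shows "arc (\<tau>, \<phi>, B) s = arc (\<tau>, \<phi>, B) t \<longleftrightarrow> jcong \<tau> \<phi> B s t"
proof -
  let ?f = "\<lambda>t q. if q = (\<tau>, \<phi>, B) then t else JConst 0"
  have "jequiv (\<tau>, \<phi>, B) s s" "jequiv (\<tau>, \<phi>, B) t t"
    using assms by (simp_all add: jequiv_iff jcong.refl)
  then have "jequivs (?f s) (?f s)" "jequivs (?f t) (?f t)"
    by (simp_all only: jequivs_arc)
  then have "arc (\<tau>, \<phi>, B) s = arc (\<tau>, \<phi>, B) t \<longleftrightarrow> jequivs (?f s) (?f t)"
    unfolding arc_def using Quotient_rel[OF Quotient_arcs, of "?f s" "?f t"] by blast
  with assms show ?thesis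
    by (simp only: jequivs_arc jequiv_iff simp_thms)
qed

lemma arc_zero: "arc p (JConst 0) = 0"
  by (simp add: arc_def zero_arcs_def)

lemma arc_hom:
  assumes "jwf B s"
  shows "arc (\<tau>, \<phi>, B) (JNeg s) = - arc (\<tau>, \<phi>, B) s"
    and "arc (\<tau>, \<phi>, B) (JDer s) = arc_der (arc (\<tau>, \<phi>, B) s)"
    and "jwf B t \<Longrightarrow> arc (\<tau>, \<phi>, B) (JAdd s t) = arc (\<tau>, \<phi>, B) s + arc (\<tau>, \<phi>, B) t"
    and "jwf B t \<Longrightarrow> arc (\<tau>, \<phi>, B) (JMul s t) = arc (\<tau>, \<phi>, B) s * arc (\<tau>, \<phi>, B) t"
proof -
  let ?p = "(\<tau>, \<phi>, B)"
  have refl: "jequiv ?p t t" if "jwf B t" for t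
    using that by (simp add: jequiv_iff jcong.refl)
  note abs_eqs = plus_arcs.abs_eq times_arcs.abs_eq uminus_arcs.abs_eq arc_der.abs_eq
    jequivs_arc refl assms
  show "arc ?p (JNeg s) = - arc ?p s" "arc ?p (JDer s) = arc_der (arc ?p s)"
    unfolding arc_def
    by (simp add: abs_eqs, rule abs_arcs_eqI,
        simp add: jequivs_def jequiv_zero jequiv_cong refl assms del: split_paired_All)+
  assume t: "jwf B t"
  show "arc ?p (JAdd s t) = arc ?p s + arc ?p t" "arc ?p (JMul s t) = arc ?p s * arc ?p t"
    unfolding arc_def
    by (simp add: abs_eqs t, rule abs_arcs_eqI,
        simp add: jequivs_def jequiv_zero jequiv_cong refl assms t del: split_paired_All)+
qed

subsection \<open>Linear maps on the free module of differentials\<close>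

text \<open>\<open>\<psi> a g\<close> is the prescribed value on \<open>a dg\<close>. The values lie
  in a mere abelian group, since the later target, the arc algebra, is not given as an
  \<open>A\<close>-module; additivity in \<open>a\<close> replaces linearity.\<close>

definition lin_ext :: "('a::comm_ring_1 \<Rightarrow> 'a \<Rightarrow> 'b::ab_group_add) \<Rightarrow> ('a \<Rightarrow> 'a) \<Rightarrow> 'b" where
  "lin_ext \<psi> x = (\<Sum>g\<in>{g. x g \<noteq> 0}. \<psi> (x g) g)"

lemma contr_eq_lin_ext: "contr \<tau> = lin_ext (\<lambda>a g. a * \<tau> g)"
  by (simp add: fun_eq_iff contr_def lin_ext_def)

lemma fin_supp_zero: "fin_supp (\<lambda>_. 0)"
  by (simp add: fin_supp_def)

lemma fin_supp_add:
  fixes x y :: "'a \<Rightarrow> 'b::comm_ring_1"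
  assumes "fin_supp x" "fin_supp y"
  shows "fin_supp (\<lambda>h. x h + y h)"
  using assms unfolding fin_supp_def
  by (rule_tac finite_subset[of _ "{g. x g \<noteq> 0} \<union> {g. y g \<noteq> 0}"]) auto

lemma fin_supp_scale:
  fixes x :: "'a \<Rightarrow> 'b::comm_ring_1"
  assumes "fin_supp x"
  shows "fin_supp (\<lambda>h. a * x h)"
  using assms unfolding fin_supp_def
  by (rule_tac finite_subset[of _ "{g. x g \<noteq> 0}"]) auto

lemma fin_supp_minus:
  fixes x :: "'a \<Rightarrow> 'b::comm_ring_1"
  assumes "fin_supp x"
  shows "fin_supp (\<lambda>h. - x h)"
  using assms by (simp add: fin_supp_def)

lemma fin_supp_dsym: "fin_supp (dsym g)"
  unfolding fin_supp_def dsym_def by simp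

lemma fin_supp_induct [consumes 1, case_names zero add]:
  fixes x :: "'a::comm_ring_1 \<Rightarrow> 'a"
  assumes "fin_supp x"
    and zero: "P (\<lambda>_. 0)"
    and add: "\<And>x a g. fin_supp x \<Longrightarrow> P x \<Longrightarrow> P (\<lambda>h. x h + a * dsym g h)"
  shows "P x"
proof -
  have "finite S \<Longrightarrow> {g. x g \<noteq> 0} \<subseteq> S \<Longrightarrow> P x" for S and x :: "'a \<Rightarrow> 'a"
  proof (induction S arbitrary: x rule: finite_induct)
    case empty
    then have "x = (\<lambda>_. 0)" by auto
    with zero show ?case by simp
  next
    case (insert g S)
    have sub: "{h. (x(g := 0)) h \<noteq> 0} \<subseteq> S" using insert.prems by auto
    have "fin_supp (x(g := 0))"
      unfolding fin_supp_def using sub insert.hyps(1) by (rule finite_subset)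
    from add[OF this insert.IH[OF sub], of "x g" g]
    have "P (\<lambda>h. (x(g := 0)) h + x g * dsym g h)" .
    also have "(\<lambda>h. (x(g := 0)) h + x g * dsym g h) = x"
      by (auto simp: fun_eq_iff dsym_def)
    finally show ?case .
  qed
  with assms(1) show ?thesis by (auto simp: fin_supp_def)
qed

lemma lin_ext_zero: "lin_ext \<psi> (\<lambda>_. 0) = 0"
  by (simp add: lin_ext_def)

context
  fixes \<psi> :: "'a::comm_ring_1 \<Rightarrow> 'a \<Rightarrow> 'b::ab_group_add"
  assumes \<psi>_add: "\<And>a b g. \<psi> (a + b) g = \<psi> a g + \<psi> b g"
begin

private lemma \<psi>_zero: "\<psi> 0 g = 0"
  using \<psi>_add[of 0 0 g] by simp

private lemma lin_ext_superset:
  assumes "finite S" "{g. x g \<noteq> 0} \<subseteq> S"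
  shows "lin_ext \<psi> x = (\<Sum>g\<in>S. \<psi> (x g) g)"
  unfolding lin_ext_def using assms by (intro sum.mono_neutral_left) (auto simp: \<psi>_zero)

lemma lin_ext_add:
  assumes "fin_supp x" "fin_supp y"
  shows "lin_ext \<psi> (\<lambda>h. x h + y h) = lin_ext \<psi> x + lin_ext \<psi> y"
proof -
  let ?S = "{g. x g \<noteq> 0} \<union> {g. y g \<noteq> 0}"
  have "finite ?S" using assms by (simp add: fin_supp_def)
  then have "lin_ext \<psi> z = (\<Sum>g\<in>?S. \<psi> (z g) g)" if "{g. z g \<noteq> 0} \<subseteq> ?S" for z
    using that by (rule lin_ext_superset)
  moreover have "{g. x g + y g \<noteq> 0} \<subseteq> ?S" by auto
  ultimately show ?thesis
    by (simp add: \<psi>_add sum.distrib)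
qed

lemma lin_ext_dsym: "lin_ext \<psi> (\<lambda>h. a * dsym g h) = \<psi> a g"
  by (subst lin_ext_superset[of "{g}"]) (auto simp: dsym_def)

text \<open>The universal property of the quotient of \<open>\<Omega>\<close> by \<open>\<iota>\<^sub>\<tau>(\<Lambda>\<^sup>2 \<Omega>)\<close>.\<close>

lemma lin_ext_span:
  assumes "\<And>a g h. \<psi> a (g + h) = \<psi> a g + \<psi> a h"
    and "\<And>a g h. \<psi> a (g * h) = \<psi> (a * g) h + \<psi> (a * h) g"
    and "\<And>a c. \<psi> a (\<phi> c) = 0"
    and "\<And>a g h. \<psi> (a * \<tau> g) h = \<psi> (a * \<tau> h) g"
    and "x \<in> amod_span (kaehler_relations \<phi> \<union> wedge2_image \<tau>)"
  shows "fin_supp x \<and> lin_ext \<psi> x = 0"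
  using assms(5)
proof induction
  case zero
  show ?case by (simp add: fin_supp_zero lin_ext_zero)
next
  case (add x y)
  then show ?case by (simp add: fin_supp_add lin_ext_add)
next
  case (smul s a)
  have neg: "\<psi> (- b) g = - \<psi> b g" for b g
    using \<psi>_add[of b "- b" g] by (simp add: \<psi>_zero eq_neg_iff_add_eq_0 add.commute)
  have fs: "fin_supp (\<lambda>h. b * dsym g h)" for b g :: 'a
    by (intro fin_supp_scale fin_supp_dsym)
  \<comment> \<open>\<open>\<psi>\<close> sees only pairs of a coefficient and a symbol, so each
    multiple of a relation is rewritten below as a sum of at most three such terms, with the signs
    moved into the coefficients.\<close>
  have two: "fin_supp (\<lambda>h. a1 * dsym g1 h + a2 * dsym g2 h) \<and>
      lin_ext \<psi> (\<lambda>h. a1 * dsym g1 h + a2 * dsym g2 h) = \<psi> a1 g1 + \<psi> a2 g2" for a1 a2 g1 g2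
    by (simp add: fs fin_supp_add lin_ext_add lin_ext_dsym)
  have three: "fin_supp (\<lambda>h. a1 * dsym g1 h + (a2 * dsym g2 h + a3 * dsym g3 h)) \<and>
      lin_ext \<psi> (\<lambda>h. a1 * dsym g1 h + (a2 * dsym g2 h + a3 * dsym g3 h)) =
        \<psi> a1 g1 + (\<psi> a2 g2 + \<psi> a3 g3)" for a1 a2 a3 g1 g2 g3
    using two by (simp add: fs fin_supp_add lin_ext_add lin_ext_dsym)
  from smul consider
      g h where "s = (\<lambda>u. dsym (g + h) u - dsym g u - dsym h u)"
    | g h where "s = (\<lambda>u. dsym (g * h) u - g * dsym h u - h * dsym g u)"
    | c where "s = dsym (\<phi> c)"
    | g h where "s = (\<lambda>u. \<tau> g * dsym h u - \<tau> h * dsym g u)"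
    unfolding kaehler_relations_def wedge2_image_def by blast
  then show ?case
  proof cases
    case 1
    have "(\<lambda>u. a * s u) = (\<lambda>u. a * dsym (g + h) u + ((-a) * dsym g u + (-a) * dsym h u))"
      by (simp only: 1) (simp add: algebra_simps)
    then show ?thesis using three[of a "g + h" "-a" g "-a" h] by (simp add: assms neg)
  next
    case 2
    have "(\<lambda>u. a * s u) =
        (\<lambda>u. a * dsym (g * h) u + ((-(a * g)) * dsym h u + (-(a * h)) * dsym g u))"
      by (simp only: 2) (simp add: algebra_simps)
    then show ?thesis
      using three[of a "g * h" "-(a * g)" h "-(a * h)" g] by (simp add: assms neg)
  next
    case 3
    then show ?thesis by (simp add: fs lin_ext_dsym assms)
  next
    case 4
    have "(\<lambda>u. a * s u) = (\<lambda>u. (a * \<tau> g) * dsym h u + (-(a * \<tau> h)) * dsym g u)"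
      by (simp only: 4) (simp add: algebra_simps)
    then show ?thesis
      using two[of "a * \<tau> g" h "-(a * \<tau> h)" g] by (simp add: assms(4) neg)
  qed
qed

end

lemma contr_add:
  "fin_supp x \<Longrightarrow> fin_supp y \<Longrightarrow> contr \<tau> (\<lambda>h. x h + y h) = contr \<tau> x + contr \<tau> y"
  unfolding contr_eq_lin_ext by (rule lin_ext_add) (auto simp: algebra_simps)

lemma contr_dsym: "contr \<tau> (\<lambda>h. a * dsym g h) = a * \<tau> g" "contr \<tau> (dsym g) = \<tau> g"
proof -
  show *: "contr \<tau> (\<lambda>h. a * dsym g h) = a * \<tau> g" for a
    unfolding contr_eq_lin_ext by (rule lin_ext_dsym) (auto simp: algebra_simps)
  show "contr \<tau> (dsym g) = \<tau> g" using *[of 1] by simp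
qed

lemma contr_zero: "contr \<tau> (\<lambda>_. 0) = 0"
  by (simp add: contr_def)

lemma contr_scale: "fin_supp x \<Longrightarrow> contr \<tau> (\<lambda>h. a * x h) = a * contr \<tau> x"
proof (induction rule: fin_supp_induct)
  case (add x b g)
  have "(\<lambda>h. a * (x h + b * dsym g h)) = (\<lambda>h. a * x h + (a * b) * dsym g h)"
    by (simp add: fun_eq_iff algebra_simps)
  with add contr_dsym(1)[of \<tau> "a * b" g] show ?case
    by (simp add: contr_add contr_dsym fin_supp_scale fin_supp_dsym distrib_left mult.assoc)
qed (simp add: contr_zero)

lemma contr_diff:
  assumes "fin_supp x" "fin_supp y"
  shows "contr \<tau> (\<lambda>h. x h - y h) = contr \<tau> x - contr \<tau> y"
  using contr_add[OF assms(1) fin_supp_scale[OF assms(2), of "-1"]] contr_scale[OF assms(2), of \<tau> "-1"]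
  by simp

lemma amod_span_scale: "x \<in> amod_span S \<Longrightarrow> (\<lambda>h. a * x h) \<in> amod_span S"
proof (induction rule: amod_span.induct)
  case zero
  show ?case using amod_span.zero by simp
next
  case (smul s b)
  then show ?case using amod_span.smul[of s S "a * b"] by (simp add: mult.assoc)
next
  case (add x y)
  from amod_span.add[OF add.IH] show ?case by (simp add: distrib_left)
qed

lemma amod_span_base: "x \<in> S \<Longrightarrow> x \<in> amod_span S"
  using amod_span.smul[of x S 1] by simp

subsection \<open>From the isomorphism to vanishing homology\<close>

locale k_diff_algebra =
  fixes \<phi> :: "'k::field \<Rightarrow> 'a::comm_ring_1" and \<tau> :: "'a \<Rightarrow> 'a"
  assumes k_algebra: "is_k_algebra \<phi>" and k_derivation: "is_k_derivation \<phi> \<tau>"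
begin

lemma \<phi>_one: "\<phi> 1 = 1" and \<phi>_add: "\<phi> (c + d) = \<phi> c + \<phi> d" and \<phi>_mult: "\<phi> (c * d) = \<phi> c * \<phi> d"
  using k_algebra by (auto simp: is_k_algebra_def)

lemma \<phi>_zero: "\<phi> 0 = 0"
  using \<phi>_add[of 0 0] by simp

lemma \<phi>_minus_one: "\<phi> (- 1) = - 1"
  using \<phi>_add[of "- 1" 1] by (simp add: \<phi>_zero \<phi>_one eq_neg_iff_add_eq_0)

lemma \<tau>_add: "\<tau> (a + b) = \<tau> a + \<tau> b" and \<tau>_mult: "\<tau> (a * b) = a * \<tau> b + b * \<tau> a"
  and \<tau>_\<phi>: "\<tau> (\<phi> c) = 0"
  using k_derivation by (auto simp: is_k_derivation_def)

section \<open>Equality in the quotient module \<open>M\<close>\<close>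

definition rels :: "('a \<Rightarrow> 'a) set" where
  "rels = amod_span (kaehler_relations \<phi> \<union> wedge2_image \<tau>)"

definition rel_eq :: "('a \<Rightarrow> 'a) \<Rightarrow> ('a \<Rightarrow> 'a) \<Rightarrow> bool" where
  "rel_eq x y \<longleftrightarrow> (\<lambda>h. x h - y h) \<in> rels"

lemma rels_zero: "(\<lambda>_. 0) \<in> rels"
  and rels_add: "x \<in> rels \<Longrightarrow> y \<in> rels \<Longrightarrow> (\<lambda>h. x h + y h) \<in> rels"
  and rels_scale: "x \<in> rels \<Longrightarrow> (\<lambda>h. a * x h) \<in> rels"
  unfolding rels_def by (auto intro: amod_span.zero amod_span.add amod_span_scale)

lemma rel_eq_refl: "rel_eq x x"
  by (simp add: rel_eq_def rels_zero)

lemma rel_eq_sym: "rel_eq x y \<Longrightarrow> rel_eq y x"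
  unfolding rel_eq_def by (drule rels_scale[where a = "- 1"]) simp

lemma rel_eq_trans: "rel_eq x y \<Longrightarrow> rel_eq y z \<Longrightarrow> rel_eq x z"
  unfolding rel_eq_def by (drule (1) rels_add) simp

lemma rel_eq_add: "rel_eq x x' \<Longrightarrow> rel_eq y y' \<Longrightarrow> rel_eq (\<lambda>h. x h + y h) (\<lambda>h. x' h + y' h)"
  unfolding rel_eq_def by (drule (1) rels_add) (simp add: algebra_simps)

lemma rel_eq_scale: "rel_eq x x' \<Longrightarrow> rel_eq (\<lambda>h. a * x h) (\<lambda>h. a * x' h)"
  unfolding rel_eq_def by (drule rels_scale[where a = a]) (simp add: algebra_simps)

lemma rel_eq_minus: "rel_eq x x' \<Longrightarrow> rel_eq (\<lambda>h. - x h) (\<lambda>h. - x' h)"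
  using rel_eq_scale[of x x' "- 1"] by simp

text \<open>Contraction descends to \<open>M\<close>: it extends
  \<open>\<psi> a g = a * \<tau> g\<close>, and \<open>\<tau> g dh - \<tau> h dg\<close> contracts
  to zero because \<open>A\<close> is commutative.\<close>

lemma rel_eq_contr:
  assumes "rel_eq x y" "fin_supp x" "fin_supp y"
  shows "contr \<tau> x = contr \<tau> y"
proof -
  have "fin_supp (\<lambda>h. x h - y h) \<and> lin_ext (\<lambda>a g. a * \<tau> g) (\<lambda>h. x h - y h) = 0"
    using assms(1) unfolding rel_eq_def rels_def
    by (rule lin_ext_span[rotated 5]) (auto simp: \<tau>_add \<tau>_mult \<tau>_\<phi> algebra_simps)
  with assms(2,3) show ?thesis
    by (simp add: contr_diff flip: contr_eq_lin_ext)
qed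

text \<open>The Peiffer identity \<open>\<iota>(x) y = \<iota>(y) x\<close> in \<open>M\<close>. For
  symbols \<open>dg\<close> and \<open>dh\<close> it is a generator from
  \<open>wedge2_image\<close>; linearity extends it, first in \<open>y\<close> and then in
  \<open>x\<close>.\<close>

lemma rels_peiffer:
  assumes x: "fin_supp x" and y: "fin_supp y"
  shows "(\<lambda>h. contr \<tau> x * y h - contr \<tau> y * x h) \<in> rels"
proof -
  have 1: "(\<lambda>h. \<tau> g * y h - contr \<tau> y * dsym g h) \<in> rels" for g
    using y
  proof (induction rule: fin_supp_induct)
    case zero
    then show ?case by (simp add: contr_zero rels_zero)
  next
    case (add y a g')
    have "(\<lambda>u. \<tau> g * dsym g' u - \<tau> g' * dsym g u) \<in> rels"
      unfolding rels_def by (rule amod_span_base) (auto simp: wedge2_image_def)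
    from rels_add[OF add.IH rels_scale[OF this, of a]] add.hyps show ?case
      by (simp add: contr_add contr_dsym fin_supp_scale fin_supp_dsym algebra_simps)
  qed
  show ?thesis using x
  proof (induction rule: fin_supp_induct)
    case zero
    then show ?case by (simp add: contr_zero rels_zero)
  next
    case (add x a g)
    from rels_add[OF add.IH rels_scale[OF 1, of a]] add.hyps show ?case
      by (simp add: contr_add contr_dsym fin_supp_scale fin_supp_dsym algebra_simps)
  qed
qed

text \<open>The \<open>M\<close>-component of the value of a term in the ring \<open>A\<^sup>0 \<oplus> M\<close>; the \<open>A\<^sup>0\<close>-component is
  \<open>jeval \<tau> \<phi> t - contr \<tau> (split_form t)\<close>.\<close>

fun split_form :: "('a, 'k) jterm \<Rightarrow> 'a \<Rightarrow> 'a" where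
  "split_form (JVar a) = (\<lambda>_. 0)"
| "split_form (JConst c) = (\<lambda>_. 0)"
| "split_form (JAdd s t) = (\<lambda>h. split_form s h + split_form t h)"
| "split_form (JNeg s) = (\<lambda>h. - split_form s h)"
| "split_form (JDer s) = dsym (jeval \<tau> \<phi> s)"
| "split_form (JMul s t) =
    (\<lambda>h. jeval \<tau> \<phi> s * split_form t h + (jeval \<tau> \<phi> t - contr \<tau> (split_form t)) * split_form s h)"

lemma fin_supp_split_form: "fin_supp (split_form t)"
  by (induction t)
    (auto intro: fin_supp_zero fin_supp_add fin_supp_minus fin_supp_scale fin_supp_dsym)

lemmas contr_simps = contr_zero contr_add contr_scale contr_dsym
  fin_supp_split_form fin_supp_dsym fin_supp_scale fin_supp_add fin_supp_zero

text \<open>Each defining rule of the arc algebra is an identity in the ring of pairs. Associativity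
  and distributivity hold already for the forms themselves; commutativity of the product needs the
  Peiffer identity, and \<open>der_add\<close>, \<open>der_mul\<close>, \<open>der_const\<close>
  need the Kaehler relations.\<close>

lemma jcong_sound:
  assumes "jcong \<tau> \<phi> B s t"
  shows "jeval \<tau> \<phi> s = jeval \<tau> \<phi> t \<and> rel_eq (split_form s) (split_form t)"
  using assms
proof induction
  case (refl s)
  show ?case by (simp add: rel_eq_refl)
next
  case (sym s t)
  then show ?case by (simp add: rel_eq_sym)
next
  case (trans s t u)
  then show ?case by (auto intro: rel_eq_trans)
next
  case (cAdd s s' t t')
  then show ?case by (simp add: rel_eq_add)
next
  case (cMul s s' t t')
  \<comment> \<open>This contraction enters the coefficient of \<open>split_form s\<close> in a
    product, so congruence requires it to be well defined on \<open>M\<close>.\<close>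
  then have "contr \<tau> (split_form t) = contr \<tau> (split_form t')"
    by (simp add: rel_eq_contr fin_supp_split_form)
  with cMul show ?case by (simp add: rel_eq_add rel_eq_scale)
next
  case (cNeg s s')
  then show ?case by (simp add: rel_eq_minus)
next
  case (cDer s s')
  then show ?case by (simp add: rel_eq_refl)
next
  case (mul_assoc s t u)
  have "split_form (JMul (JMul s t) u) = split_form (JMul s (JMul t u))"
    by (simp add: contr_simps fun_eq_iff) (simp add: algebra_simps)
  then show ?case by (simp add: rel_eq_refl mult.assoc)
next
  case (mul_comm s t)
  show ?case
    using rels_peiffer[OF fin_supp_split_form fin_supp_split_form, of s t]
    by (simp add: rel_eq_def algebra_simps)
next
  case (distrib s t u)
  have "split_form (JMul s (JAdd t u)) = split_form (JAdd (JMul s t) (JMul s u))"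
    by (simp add: contr_simps fun_eq_iff algebra_simps)
  then show ?case by (simp add: rel_eq_refl distrib_left)
next
  case (der_add s t)
  have "(\<lambda>h. dsym (a + b) h - dsym a h - dsym b h) \<in> rels" for a b
    unfolding rels_def by (rule amod_span_base) (auto simp: kaehler_relations_def)
  then show ?case by (simp add: rel_eq_def \<tau>_add algebra_simps)
next
  case (der_mul s t)
  have "(\<lambda>h. dsym (a * b) h - a * dsym b h - b * dsym a h) \<in> rels" for a b
    unfolding rels_def by (rule amod_span_base) (auto simp: kaehler_relations_def)
  \<comment> \<open>After expansion the two sides differ by the Leibniz relation minus the Peiffer
    element of \<open>d(jeval s)\<close> and \<open>split_form t\<close>; the multiple of
    \<open>split_form s\<close> drops out because
    \<open>contr \<tau> (dsym g) = \<tau> g\<close>.\<close>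
  from rels_add[OF this[of "jeval \<tau> \<phi> s" "jeval \<tau> \<phi> t"] rels_scale[OF
      rels_peiffer[OF fin_supp_dsym[of "jeval \<tau> \<phi> s"] fin_supp_split_form[of t]], of "- 1"]]
  show ?case
    by (simp add: rel_eq_def \<tau>_mult contr_simps algebra_simps)
next
  case (der_const c)
  have "dsym (\<phi> c) \<in> rels"
    unfolding rels_def by (rule amod_span_base) (auto simp: kaehler_relations_def)
  then show ?case by (simp add: rel_eq_def \<tau>_\<phi> \<phi>_zero)
qed (simp_all add: contr_simps \<phi>_zero \<phi>_one \<phi>_add \<phi>_mult rel_eq_refl ac_simps)

text \<open>\<open>split_form\<close> inverts contraction: \<open>x\<close> is the form of some term
  with value \<open>contr \<tau> x\<close>. If this value is \<open>0\<close>, injectivity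
  identifies the term with \<open>JConst 0\<close>, so \<open>x\<close> vanishes in
  \<open>M\<close>.\<close>

theorem iso_imp_H_minus1:
  assumes "canonical_iso \<tau> \<phi> B"
  shows "H_minus1_vanishes \<phi> \<tau>"
  unfolding H_minus1_vanishes_def
proof (intro allI impI, elim conjE)
  fix x :: "'a \<Rightarrow> 'a"
  assume "fin_supp x" and "contr \<tau> x = 0"
  have surj: "\<exists>t. jwf B t \<and> jeval \<tau> \<phi> t = a" for a
    using assms by (simp add: canonical_iso_def)
  have "\<exists>t. jwf B t \<and> jeval \<tau> \<phi> t = contr \<tau> x \<and> split_form t = x"
    using \<open>fin_supp x\<close>
  proof (induction rule: fin_supp_induct)
    case zero
    show ?case by (rule exI[of _ "JConst 0"]) (simp add: contr_zero \<phi>_zero)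
  next
    case (add x a g)
    obtain t where "jwf B t" "jeval \<tau> \<phi> t = contr \<tau> x" "split_form t = x"
      using add.IH by blast
    moreover obtain u v where "jwf B u" "jeval \<tau> \<phi> u = a" "jwf B v" "jeval \<tau> \<phi> v = g"
      using surj by blast
    \<comment> \<open>The form of \<open>u \<partial>v\<close> is exactly \<open>a dg\<close>: the
      coefficient \<open>\<tau> g - contr \<tau> (dsym g)\<close> of \<open>split_form u\<close> is
      zero.\<close>
    ultimately show ?case using add.hyps
      by (intro exI[of _ "JAdd t (JMul u (JDer v))"]) (simp add: contr_simps fun_eq_iff)
  qed
  then obtain t where "jwf B t" and t: "jeval \<tau> \<phi> t = 0" "split_form t = x"
    using \<open>contr \<tau> x = 0\<close> by auto
  with assms have "jcong \<tau> \<phi> B t (JConst 0)"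
    unfolding canonical_iso_def by (metis jeval.simps(2) jwf.simps(2) \<phi>_zero)
  from jcong_sound[OF this] t show "x \<in> amod_span (kaehler_relations \<phi> \<union> wedge2_image \<tau>)"
    by (simp add: rel_eq_def rels_def)
qed

end

subsection \<open>From vanishing homology to the isomorphism\<close>

locale graded_diff_algebra = k_diff_algebra \<phi> \<tau>
  for \<phi> :: "'k::field \<Rightarrow> 'a::comm_ring_1" and \<tau> :: "'a \<Rightarrow> 'a" +
  fixes Agr :: "nat \<Rightarrow> 'a set"
  assumes graded: "is_graded \<phi> Agr"
    and degree_one: "degree_one Agr \<tau>"
    and diff_generated: "diff_generated \<phi> \<tau> (Agr 0)"
begin

section \<open>Homogeneous components in \<open>A\<close>\<close>

lemma Agr_zero: "0 \<in> Agr n"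
  and Agr_add: "a \<in> Agr n \<Longrightarrow> b \<in> Agr n \<Longrightarrow> a + b \<in> Agr n"
  and Agr_scale: "a \<in> Agr n \<Longrightarrow> \<phi> c * a \<in> Agr n"
  and Agr_mult: "a \<in> Agr m \<Longrightarrow> b \<in> Agr n \<Longrightarrow> a * b \<in> Agr (m + n)"
  and Agr_one: "1 \<in> Agr 0"
  using graded by (auto simp: is_graded_def)

lemma Agr_\<phi>: "\<phi> c \<in> Agr 0"
  using Agr_scale[OF Agr_one] by simp

lemma Agr_minus: "a \<in> Agr n \<Longrightarrow> - a \<in> Agr n"
  using Agr_scale[of a n "- 1"] by (simp add: \<phi>_minus_one)

lemma Agr_\<tau>: "a \<in> Agr n \<Longrightarrow> \<tau> a \<in> Agr (Suc n)"
  using degree_one by (auto simp: degree_one_def)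

lemma homogeneous_independent:
  assumes "\<forall>n. f n \<in> Agr n" "finite {n. f n \<noteq> 0}" "sum f {n. f n \<noteq> 0} = 0"
  shows "\<forall>n. f n = 0"
  using graded assms unfolding is_graded_def by (elim conjE) (erule allE[of _ f], blast)

definition component :: "'a \<Rightarrow> nat \<Rightarrow> 'a" where
  "component a = (SOME f. (\<forall>n. f n \<in> Agr n) \<and> finite {n. f n \<noteq> 0} \<and> a = (\<Sum>n\<in>{n. f n \<noteq> 0}. f n))"

lemma component:
  "component a n \<in> Agr n" "finite {n. component a n \<noteq> 0}"
  "(\<Sum>n\<in>{n. component a n \<noteq> 0}. component a n) = a"
proof -
  have "\<exists>f. (\<forall>n. f n \<in> Agr n) \<and> finite {n. f n \<noteq> 0} \<and> a = (\<Sum>n\<in>{n. f n \<noteq> 0}. f n)"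
    using graded unfolding is_graded_def by blast
  from someI_ex[OF this, folded component_def]
  show "component a n \<in> Agr n" "finite {n. component a n \<noteq> 0}"
    "(\<Sum>n\<in>{n. component a n \<noteq> 0}. component a n) = a" by auto
qed

text \<open>Two decompositions differ by a homogeneous family with sum zero, which is zero by
  independence of the degrees. \<open>S\<close> may exceed the support of \<open>f\<close>.\<close>

lemma component_unique:
  assumes f: "\<And>n. f n \<in> Agr n" "finite S" "\<And>n. n \<notin> S \<Longrightarrow> f n = 0" "a = sum f S"
  shows "component a = f"
proof -
  let ?g = "component a"
  let ?d = "\<lambda>n. f n + - ?g n"
  let ?T = "S \<union> {n. ?g n \<noteq> 0}"
  have T: "finite ?T" using f(2) component(2) by simp
  have sub: "{n. ?d n \<noteq> 0} \<subseteq> ?T" using f(3) by auto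
  have "sum f ?T = sum f S"
    using T f(3) by (intro sum.mono_neutral_right) auto
  moreover have "sum ?g ?T = sum ?g {n. ?g n \<noteq> 0}"
    using T by (intro sum.mono_neutral_right) auto
  ultimately have "sum ?d ?T = 0"
    using f(4) component(3)[of a] by (simp add: sum_subtractf)
  moreover have "sum ?d ?T = sum ?d {n. ?d n \<noteq> 0}"
    using T sub by (intro sum.mono_neutral_right) auto
  ultimately have "sum ?d {n. ?d n \<noteq> 0} = 0" by simp
  moreover have "\<forall>n. ?d n \<in> Agr n"
    using f(1) component(1) by (blast intro: Agr_add Agr_minus)
  moreover have "finite {n. ?d n \<noteq> 0}"
    using sub T by (rule finite_subset)
  ultimately show ?thesis
    using homogeneous_independent[of ?d] by (simp add: fun_eq_iff)
qed

lemma component_add: "component (a + b) n = component a n + component b n"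
proof -
  let ?S = "{n. component a n \<noteq> 0} \<union> {n. component b n \<noteq> 0}"
  have S: "finite ?S" by (simp add: component(2))
  have "sum (component c) ?S = c" if "c = a \<or> c = b" for c
    using that S component(3)[of c]
    by (subst sum.mono_neutral_right[of _ "{n. component c n \<noteq> 0}"]) auto
  from this[of a] this[of b]
  have "component (a + b) = (\<lambda>n. component a n + component b n)"
    by (intro component_unique[of _ ?S]) (auto simp: component Agr_add sum.distrib)
  then show ?thesis by simp
qed

lemma component_homogeneous:
  assumes "a \<in> Agr i"
  shows "component a n = (if n = i then a else 0)"
proof -
  have "component a = (\<lambda>n. if n = i then a else 0)"
    using assms by (intro component_unique[of _ "{i}"]) (auto simp: Agr_zero)
  then show ?thesis by simp
qed

lemma homogeneous_induct [case_names homogeneous add]: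
  assumes hom: "\<And>n a. a \<in> Agr n \<Longrightarrow> P a"
    and add: "\<And>a b. P a \<Longrightarrow> P b \<Longrightarrow> P (a + b)"
  shows "P a"
proof -
  have "finite S \<Longrightarrow> P (sum (component a) S)" for S
    by (induction S rule: finite_induct) (auto intro: hom add component(1) Agr_zero)
  from this[OF component(2)[of a]] show ?thesis by (simp add: component(3))
qed

section \<open>Homogeneous elements of the arc algebra and their images in \<open>A\<close>\<close>

abbreviation J :: "('a, 'k) jterm \<Rightarrow> ('a, 'k) arcs" where
  "J \<equiv> arc (\<tau>, \<phi>, Agr 0)"

text \<open>\<open>lifts n x a\<close>: the element \<open>x\<close> of degree \<open>n\<close> of the arc algebra maps to \<open>a\<close>.\<close>

inductive lifts :: "nat \<Rightarrow> ('a, 'k) arcs \<Rightarrow> 'a \<Rightarrow> bool" where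
  var: "a \<in> Agr 0 \<Longrightarrow> lifts 0 (J (JVar a)) a"
| const: "lifts 0 (J (JConst c)) (\<phi> c)"
| zero: "lifts n 0 0"
| add: "lifts n x a \<Longrightarrow> lifts n y b \<Longrightarrow> lifts n (x + y) (a + b)"
| minus: "lifts n x a \<Longrightarrow> lifts n (- x) (- a)"
| mult: "lifts m x a \<Longrightarrow> lifts n y b \<Longrightarrow> lifts (m + n) (x * y) (a * b)"
| der: "lifts n x a \<Longrightarrow> lifts (Suc n) (arc_der x) (\<tau> a)"

lemma lifts_Agr: "lifts n x a \<Longrightarrow> a \<in> Agr n"
  by (induction rule: lifts.induct)
    (auto intro: Agr_zero Agr_\<phi> Agr_add Agr_minus Agr_mult Agr_\<tau>)

lemma J_eq: "jcong \<tau> \<phi> (Agr 0) s t \<Longrightarrow> jwf (Agr 0) s \<Longrightarrow> jwf (Agr 0) t \<Longrightarrow> J s = J t"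
  by (simp add: arc_eq_iff)

lemma lifts_term: "lifts n x a \<Longrightarrow> \<exists>t. jwf (Agr 0) t \<and> J t = x"
proof (induction rule: lifts.induct)
  case (var a)
  then show ?case by (intro exI[of _ "JVar a"]) simp
next
  case (const c)
  show ?case by (intro exI[of _ "JConst c"]) simp
next
  case (zero n)
  show ?case by (intro exI[of _ "JConst 0"]) (simp add: arc_zero)
next
  case (add n x a y b)
  then show ?case by (metis arc_hom(3) jwf.simps(3))
next
  case (minus n x a)
  then show ?case by (metis arc_hom(1) jwf.simps(5))
next
  case (mult m x a n y b)
  then show ?case by (metis arc_hom(4) jwf.simps(4))
next
  case (der n x a)
  then show ?case by (metis arc_hom(2) jwf.simps(6))
qed

text \<open>\<open>J (JConst 1)\<close> is the unit of only one factor of the product;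
  \<open>lifts n x a\<close> ensures that \<open>x\<close> lies in that factor.\<close>

lemma J_one_mult:
  assumes "lifts n x a"
  shows "J (JConst 1) * x = x"
proof -
  obtain t where t: "jwf (Agr 0) t" "J t = x" using lifts_term[OF assms] by blast
  have "jcong \<tau> \<phi> (Agr 0) (JMul (JConst 1) t) t"
    using t(1) by (intro jcong.trans[OF jcong.mul_comm jcong.mul_one]) simp_all
  then have "J (JMul (JConst 1) t) = J t"
    using t(1) by (intro J_eq) simp_all
  then show ?thesis using t by (simp add: arc_hom)
qed

lemma arc_der_const: "arc_der (J (JConst c)) = 0"
  using J_eq[OF jcong.der_const] by (simp add: arc_hom arc_zero)

lemma J_var:
  "J (JVar (\<phi> c)) = J (JConst c)"
  "a \<in> Agr 0 \<Longrightarrow> b \<in> Agr 0 \<Longrightarrow> J (JVar (a + b)) = J (JVar a) + J (JVar b)"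
  "a \<in> Agr 0 \<Longrightarrow> b \<in> Agr 0 \<Longrightarrow> J (JVar (a * b)) = J (JVar a) * J (JVar b)"
proof -
  show "J (JVar (\<phi> c)) = J (JConst c)"
    by (rule J_eq) (auto intro: jcong.var_const Agr_\<phi>)
  assume ab: "a \<in> Agr 0" "b \<in> Agr 0"
  have "J (JVar (a + b)) = J (JAdd (JVar a) (JVar b))" "J (JVar (a * b)) = J (JMul (JVar a) (JVar b))"
    using ab Agr_mult[of a 0 b 0] by (auto intro!: J_eq jcong.var_add jcong.var_mul Agr_add)
  with ab show "J (JVar (a + b)) = J (JVar a) + J (JVar b)"
    "J (JVar (a * b)) = J (JVar a) * J (JVar b)"
    by (simp_all add: arc_hom)
qed

lemma J_var_zero: "J (JVar 0) = 0"
  using J_var(1)[of 0] by (simp add: \<phi>_zero arc_zero)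

text \<open>Derivation raises the degree, so degree \<open>0\<close> is built from variables and
  constants by ring operations, which collapse to a single variable. This is the base of the
  induction on the degree.\<close>

lemma lifts_degree_zero: "lifts 0 x a \<Longrightarrow> x = J (JVar a)"
proof (induction "0::nat" x a rule: lifts.induct)
  case (minus x a)
  then have "J (JVar (- a)) + J (JVar a) = 0"
    using J_var(2)[of "- a" a] lifts_Agr[of 0] by (simp add: Agr_minus J_var_zero)
  then have "J (JVar (- a)) = - J (JVar a)" by (rule eq_neg_iff_add_eq_0[THEN iffD2])
  with minus show ?case by simp
next
  case (add x a y b)
  then show ?case using lifts_Agr[OF add.hyps(1)] lifts_Agr[OF add.hyps(3)] by (simp add: J_var)
next
  case (mult m x a n y b)
  then show ?case using lifts_Agr[OF mult.hyps(1)] lifts_Agr[OF mult.hyps(3)] by (simp add: J_var)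
qed (simp_all add: J_var J_var_zero)

text \<open>Inhomogeneous counterpart of \<open>lifts\<close>: an element and its image, split into
  matching homogeneous summands. It takes the place of a grading on the arc algebra.\<close>

inductive decomposes :: "('a, 'k) arcs \<Rightarrow> 'a \<Rightarrow> bool" where
  single: "lifts n x a \<Longrightarrow> decomposes x a"
| add: "decomposes x a \<Longrightarrow> decomposes y b \<Longrightarrow> decomposes (x + y) (a + b)"

lemma decomposes_minus: "decomposes x a \<Longrightarrow> decomposes (- x) (- a)"
proof (induction rule: decomposes.induct)
  case (add x a y b)
  from decomposes.add[OF add.IH] show ?case by simp
qed (auto intro: decomposes.single lifts.minus)

lemma decomposes_der: "decomposes x a \<Longrightarrow> decomposes (arc_der x) (\<tau> a)"
proof (induction rule: decomposes.induct)
  case (add x a y b)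
  from decomposes.add[OF add.IH] show ?case by (simp add: arc_der_add \<tau>_add)
qed (auto intro: decomposes.single lifts.der)

lemma decomposes_mult:
  assumes "decomposes x a" "decomposes y b"
  shows "decomposes (x * y) (a * b)"
proof -
  have *: "decomposes (x * y) (a * b)" if "lifts n x a" for n x a
    using assms(2)
  proof (induction rule: decomposes.induct)
    case (single m y b)
    then show ?case using that by (blast intro: decomposes.single lifts.mult)
  next
    case (add y b y' b')
    from decomposes.add[OF add.IH] show ?case by (simp add: distrib_left)
  qed
  from assms(1) show ?thesis
  proof (induction rule: decomposes.induct)
    case (single n x a)
    then show ?case by (rule *)
  next
    case (add x a x' a')
    from decomposes.add[OF add.IH] show ?case by (simp add: distrib_right)
  qed
qed

lemma decomposes_term: "jwf (Agr 0) t \<Longrightarrow> decomposes (J t) (jeval \<tau> \<phi> t)"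
  by (induction t)
    (auto simp: arc_hom intro: decomposes.single decomposes.add decomposes_minus decomposes_mult
      decomposes_der lifts.var lifts.const)

lemma decomposes_components:
  "decomposes x a \<Longrightarrow> \<exists>f g S. finite S \<and> (\<forall>i. lifts i (f i) (g i)) \<and>
    (\<forall>i. i \<notin> S \<longrightarrow> f i = 0 \<and> g i = 0) \<and> x = sum f S \<and> a = sum g S"
proof (induction rule: decomposes.induct)
  case (single n x a)
  then show ?case
    by (intro exI[of _ "\<lambda>i. if i = n then x else 0"] exI[of _ "\<lambda>i. if i = n then a else 0"]
        exI[of _ "{n}"]) (auto intro: lifts.zero)
next
  case (add x a y b)
  then obtain f g S f' g' S' where
    1: "finite S" "\<forall>i. lifts i (f i) (g i)" "\<forall>i. i \<notin> S \<longrightarrow> f i = 0 \<and> g i = 0"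
      "x = sum f S" "a = sum g S" and
    2: "finite S'" "\<forall>i. lifts i (f' i) (g' i)" "\<forall>i. i \<notin> S' \<longrightarrow> f' i = 0 \<and> g' i = 0"
      "y = sum f' S'" "b = sum g' S'"
    by blast
  have "sum f (S \<union> S') = x" "sum g (S \<union> S') = a" "sum f' (S \<union> S') = y" "sum g' (S \<union> S') = b"
    using 1 2 by (auto intro!: sum.mono_neutral_right)
  then show ?case using 1 2
    by (intro exI[of _ "\<lambda>i. f i + f' i"] exI[of _ "\<lambda>i. g i + g' i"] exI[of _ "S \<union> S'"])
      (auto simp: sum.distrib intro: lifts.add)
qed

lemma jeval_surj: "\<exists>t. jwf (Agr 0) t \<and> jeval \<tau> \<phi> t = a"
proof -
  have "a \<in> alg_closure \<phi> (\<Union>j. (\<tau> ^^ j) ` Agr 0)"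
    using diff_generated by (simp add: diff_generated_def)
  then show ?thesis
  proof (induction rule: alg_closure.induct)
    case (gen a)
    then obtain j b where "b \<in> Agr 0" "a = (\<tau> ^^ j) b" by blast
    then show ?case
    proof (induction j arbitrary: a)
      case 0
      then show ?case by (intro exI[of _ "JVar b"]) simp
    next
      case (Suc j)
      then obtain t where "jwf (Agr 0) t" "jeval \<tau> \<phi> t = (\<tau> ^^ j) b" by blast
      with Suc show ?case by (intro exI[of _ "JDer t"]) simp
    qed
  next
    case (scal c)
    show ?case by (intro exI[of _ "JConst c"]) simp
  next
    case (add x y)
    then show ?case by (metis jeval.simps(3) jwf.simps(3))
  next
    case (mult x y)
    then show ?case by (metis jeval.simps(4) jwf.simps(4))
  qed
qed

text \<open>An arbitrary preimage of \<open>a\<close> may be inhomogeneous; its part of degree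
  \<open>n\<close> maps to the component of \<open>a\<close> in degree \<open>n\<close>, which is
  \<open>a\<close> itself.\<close>

lemma lifts_surj:
  assumes "a \<in> Agr n"
  shows "\<exists>x. lifts n x a"
proof -
  obtain t where "jwf (Agr 0) t" "jeval \<tau> \<phi> t = a" using jeval_surj by blast
  then have "decomposes (J t) a" using decomposes_term by blast
  then obtain f g S where "finite S" and l: "\<forall>i. lifts i (f i) (g i)"
    and "\<forall>i. i \<notin> S \<longrightarrow> f i = 0 \<and> g i = 0" "a = sum g S"
    using decomposes_components by blast
  then have "component a = g"
    by (intro component_unique[of _ S]) (auto intro: lifts_Agr)
  with component_homogeneous[OF assms, of n] have "g n = a" by simp
  with l show ?thesis by metis
qed

text \<open>\<open>lifts_form n x w\<close>: the form \<open>w\<close> is homogeneous of degree \<open>n\<close>, and \<open>x\<close> arises from a lift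
  of \<open>w\<close> to the arc algebra by contraction with the universal derivation.\<close>

inductive lifts_form :: "nat \<Rightarrow> ('a, 'k) arcs \<Rightarrow> ('a \<Rightarrow> 'a) \<Rightarrow> bool" where
  zero: "lifts_form n 0 (\<lambda>_. 0)"
| step: "lifts_form (i + j) x w \<Longrightarrow> lifts i y b \<Longrightarrow> lifts j z c \<Longrightarrow>
    lifts_form (i + j) (x + y * arc_der z) (\<lambda>h. w h + b * dsym c h)"

lemma lifts_form_fin_supp: "lifts_form n x w \<Longrightarrow> fin_supp w"
  by (induction rule: lifts_form.induct)
    (simp_all add: fin_supp_zero fin_supp_add fin_supp_scale fin_supp_dsym)

lemma lifts_form_add:
  assumes "lifts_form n x w" "lifts_form n x' w'"
  shows "lifts_form n (x' + x) (\<lambda>h. w' h + w h)"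
  using assms
proof (induction rule: lifts_form.induct)
  case (step i j x w y b z c)
  from lifts_form.step[OF step.IH[OF step.prems] step.hyps(2,3)] show ?case
    by (simp add: add.assoc)
qed simp

lemma lifts_form_minus: "lifts_form n x w \<Longrightarrow> lifts_form n (- x) (\<lambda>h. - w h)"
proof (induction rule: lifts_form.induct)
  case (step i j x w y b z c)
  from lifts_form.step[OF step.IH lifts.minus[OF step.hyps(2)] step.hyps(3)] show ?case
    by simp
qed (simp add: lifts_form.zero)

lemma lifts_form_mult:
  assumes "lifts_form n x w" "lifts m u e"
  shows "lifts_form (m + n) (u * x) (\<lambda>h. e * w h)"
  using assms(1)
proof (induction rule: lifts_form.induct)
  case (step i j x w y b z c)
  have "lifts_form ((m + i) + j) (u * x) (\<lambda>h. e * w h)"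
    using step.IH by (simp add: add.assoc)
  from lifts_form.step[OF this lifts.mult[OF assms(2) step.hyps(2)] step.hyps(3)] show ?case
    by (simp add: distrib_left mult.assoc add.assoc)
qed (simp add: lifts_form.zero)

text \<open>A product of positive degree has a factor of positive degree; the form of that factor is
  multiplied by the other factor.\<close>

lemma lifts_Suc_form:
  assumes "lifts (Suc n) x a"
  shows "\<exists>w. lifts_form n x w \<and> contr \<tau> w = a"
proof -
  have "lifts m x a \<Longrightarrow> m = Suc n \<Longrightarrow> ?thesis" for m
  proof (induction arbitrary: n rule: lifts.induct)
    case (zero m)
    show ?case using lifts_form.zero contr_zero by blast
  next
    case (add m x a y b)
    then obtain v w where vw: "lifts_form n x v" "contr \<tau> v = a" "lifts_form n y w" "contr \<tau> w = b"
      by blast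
    then have "contr \<tau> (\<lambda>h. v h + w h) = a + b"
      using contr_add[OF lifts_form_fin_supp lifts_form_fin_supp] by blast
    with lifts_form_add[OF vw(3,1)] show ?case by blast
  next
    case (minus m x a)
    then obtain w where w: "lifts_form n x w" "contr \<tau> w = a" by blast
    then have "contr \<tau> (\<lambda>h. - w h) = - a"
      using contr_scale[OF lifts_form_fin_supp, of n x w \<tau> "- 1"] by simp
    with lifts_form_minus[OF w(1)] show ?case by blast
  next
    case (mult m x a l y b)
    show ?case
    proof (cases m)
      case 0
      then obtain w where w: "lifts_form n y w" "contr \<tau> w = b" using mult by auto
      then have "contr \<tau> (\<lambda>h. a * w h) = a * b"
        using contr_scale[OF lifts_form_fin_supp] by blast
      with lifts_form_mult[OF w(1) mult.hyps(1)] 0 show ?thesis by auto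
    next
      case (Suc m')
      then obtain w where w: "lifts_form m' x w" "contr \<tau> w = a" using mult.IH(1) by blast
      then have "contr \<tau> (\<lambda>h. b * w h) = b * a"
        using contr_scale[OF lifts_form_fin_supp] by blast
      moreover have "l + m' = n" using Suc mult.prems by simp
      ultimately show ?thesis
        using lifts_form_mult[OF w(1) mult.hyps(2)] by (auto simp: mult.commute)
    qed
  next
    case (der m x a)
    \<comment> \<open>A summand of a form carries a coefficient, so \<open>\<partial>x\<close> is
      read as \<open>1 * \<partial>x\<close> with the unit of the factor.\<close>
    then have "lifts_form n (arc_der x) (dsym a)"
      using lifts_form.step[OF lifts_form.zero lifts.const[of 1] der.hyps]
        J_one_mult[OF lifts.der[OF der.hyps]] by (simp add: \<phi>_one)
    then show ?case using contr_dsym(2) by blast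
  qed simp_all
  with assms show ?thesis by blast
qed

section \<open>Inverse of evaluation up to degree \<open>n\<close>, and the induction step\<close>

context
  fixes n :: nat
  assumes kernel: "\<And>k x. k \<le> n \<Longrightarrow> lifts k x 0 \<Longrightarrow> x = 0"
begin

text \<open>By \<open>kernel\<close>, lifts are unique up to degree \<open>n\<close>, so this
  inverts evaluation there. It respects sums, products and derivatives as long as the resulting
  degree is at most \<open>n\<close>.\<close>

definition section_map :: "nat \<Rightarrow> 'a \<Rightarrow> ('a, 'k) arcs" where
  "section_map k a = (THE x. lifts k x a)"

lemma section_map_eq:
  assumes "k \<le> n" "lifts k x a"
  shows "section_map k a = x"
  unfolding section_map_def
proof (rule the_equality, rule assms(2))
  fix y assume "lifts k y a"
  from lifts.add[OF this lifts.minus[OF assms(2)]] have "lifts k (y - x) 0" by simp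
  with kernel[OF assms(1)] show "y = x" by (metis eq_iff_diff_eq_0)
qed

lemma lifts_section_map:
  assumes "k \<le> n" "a \<in> Agr k"
  shows "lifts k (section_map k a) a"
  using lifts_surj[OF assms(2)] section_map_eq[OF assms(1)] by metis

lemma section_map_zero: "k \<le> n \<Longrightarrow> section_map k 0 = 0"
  by (rule section_map_eq[OF _ lifts.zero])

lemma section_map_add:
  "k \<le> n \<Longrightarrow> a \<in> Agr k \<Longrightarrow> b \<in> Agr k \<Longrightarrow> section_map k (a + b) = section_map k a + section_map k b"
  by (intro section_map_eq lifts.add lifts_section_map)

lemma section_map_mult:
  "k + l \<le> n \<Longrightarrow> a \<in> Agr k \<Longrightarrow> b \<in> Agr l \<Longrightarrow>
    section_map (k + l) (a * b) = section_map k a * section_map l b"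
  by (intro section_map_eq lifts.mult lifts_section_map) auto

lemma section_map_der:
  "Suc k \<le> n \<Longrightarrow> a \<in> Agr k \<Longrightarrow> section_map (Suc k) (\<tau> a) = arc_der (section_map k a)"
  by (intro section_map_eq lifts.der lifts_section_map) auto

text \<open>The part of \<open>a dg\<close> of degree \<open>n\<close>, where \<open>dg\<close>
  counts with the degree of \<open>g\<close>, lifted and contracted with the universal derivation.
  Being defined on all of \<open>A\<close>, it also applies to inhomogeneous relations and keeps
  only their part of degree \<open>n\<close>.\<close>

definition lift_pairing :: "'a \<Rightarrow> 'a \<Rightarrow> ('a, 'k) arcs" where
  "lift_pairing a g = (\<Sum>i\<le>n. section_map i (component a i) *
    arc_der (section_map (n - i) (component g (n - i))))"

lemma lift_pairing_add:
  "lift_pairing (a + b) g = lift_pairing a g + lift_pairing b g"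
  "lift_pairing a (g + h) = lift_pairing a g + lift_pairing a h"
  by (simp_all add: lift_pairing_def component_add section_map_add component(1) arc_der_add
      distrib_left distrib_right sum.distrib)

lemma lift_pairing_homogeneous:
  assumes "a \<in> Agr i" "g \<in> Agr j"
  shows "lift_pairing a g = (if i + j = n then section_map i a * arc_der (section_map j g) else 0)"
proof -
  have "arc_der 0 = (0 :: ('a, 'k) arcs)"
    using arc_der_add[of 0 "0 :: ('a, 'k) arcs"] by simp
  then have "lift_pairing a g = (\<Sum>k\<le>n. if k = i then
      (if i + j = n then section_map i a * arc_der (section_map j g) else 0) else 0)"
    unfolding lift_pairing_def
    by (intro sum.cong) (auto simp: component_homogeneous[OF assms(1)]
        component_homogeneous[OF assms(2)] section_map_zero)
  then show ?thesis by auto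
qed

text \<open>For homogeneous arguments everything vanishes unless the total degree is
  \<open>n\<close>; then all products stay in the range of \<open>section_map_mult\<close>, and the
  Leibniz rule of \<open>arc_der\<close> applies.\<close>

lemma lift_pairing_mult:
  "lift_pairing a (g * h) = lift_pairing (a * g) h + lift_pairing (a * h) g"
proof (induction a rule: homogeneous_induct)
  case (homogeneous l a)
  show ?case
  proof (induction g rule: homogeneous_induct)
    case (homogeneous i g)
    show ?case
    proof (induction h rule: homogeneous_induct)
      case (homogeneous j h)
      note a = \<open>a \<in> Agr l\<close> and g = \<open>g \<in> Agr i\<close> and h = \<open>h \<in> Agr j\<close>
      show ?case
        using lift_pairing_homogeneous[OF a Agr_mult[OF g h]]
          lift_pairing_homogeneous[OF Agr_mult[OF a g] h]
          lift_pairing_homogeneous[OF Agr_mult[OF a h] g]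
          section_map_mult[OF _ g h] section_map_mult[OF _ a g] section_map_mult[OF _ a h]
        by (auto simp: arc_der_mult algebra_simps)
    qed (simp add: lift_pairing_add algebra_simps)
  qed (simp add: lift_pairing_add algebra_simps)
qed (simp add: lift_pairing_add algebra_simps)

lemma lift_pairing_const: "lift_pairing a (\<phi> c) = 0"
proof (induction a rule: homogeneous_induct)
  case (homogeneous l a)
  have "section_map 0 (\<phi> c) = J (JConst c)"
    by (intro section_map_eq lifts.const) simp
  then show ?case
    using lift_pairing_homogeneous[OF homogeneous Agr_\<phi>] by (simp add: arc_der_const)
qed (simp add: lift_pairing_add)

text \<open>With \<open>s\<close> the section, both sides are
  \<open>s(a) \<partial>s(g) \<partial>s(h)\<close>. A nonzero value forces the degrees of
  \<open>a\<close>, \<open>g\<close>, \<open>h\<close> plus one to sum to \<open>n\<close>, so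
  \<open>\<tau> g\<close> and \<open>\<tau> h\<close> have degree at most \<open>n\<close>, where
  \<open>s\<close> commutes with the derivations.\<close>

lemma lift_pairing_koszul: "lift_pairing (a * \<tau> g) h = lift_pairing (a * \<tau> h) g"
proof (induction a rule: homogeneous_induct)
  case (homogeneous l a)
  show ?case
  proof (induction g rule: homogeneous_induct)
    case (homogeneous i g)
    show ?case
    proof (induction h rule: homogeneous_induct)
      case (homogeneous j h)
      note a = \<open>a \<in> Agr l\<close> and g = \<open>g \<in> Agr i\<close> and h = \<open>h \<in> Agr j\<close>
      show ?case
        using lift_pairing_homogeneous[OF Agr_mult[OF a Agr_\<tau>[OF g]] h]
          lift_pairing_homogeneous[OF Agr_mult[OF a Agr_\<tau>[OF h]] g]
          section_map_mult[OF _ a Agr_\<tau>[OF g]] section_map_mult[OF _ a Agr_\<tau>[OF h]]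
          section_map_der[OF _ g] section_map_der[OF _ h]
        by (auto simp: algebra_simps)
    qed (simp add: lift_pairing_add \<tau>_add algebra_simps)
  qed (simp add: lift_pairing_add \<tau>_add algebra_simps)
qed (simp add: lift_pairing_add algebra_simps)

text \<open>Both factors of each summand have degree at most \<open>n\<close>, so
  \<open>section_map\<close> recovers them from \<open>b\<close> and \<open>c\<close>. Hence
  \<open>x\<close> depends only on \<open>w\<close>, not on its presentation.\<close>

lemma lin_ext_lift_pairing: "lifts_form m x w \<Longrightarrow> m = n \<Longrightarrow> lin_ext lift_pairing w = x"
proof (induction rule: lifts_form.induct)
  case (zero m)
  show ?case by (rule lin_ext_zero)
next
  case (step i j x w y b z c)
  have "lift_pairing b c = y * arc_der z"
    using step lift_pairing_homogeneous[OF lifts_Agr[OF step.hyps(2)] lifts_Agr[OF step.hyps(3)]]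
      section_map_eq[OF _ step.hyps(2)] section_map_eq[OF _ step.hyps(3)] by simp
  moreover have "lin_ext lift_pairing (\<lambda>h. w h + b * dsym c h) =
      lin_ext lift_pairing w + lin_ext lift_pairing (\<lambda>h. b * dsym c h)"
    using lift_pairing_add(1) lifts_form_fin_supp[OF step.hyps(1)]
    by (rule lin_ext_add) (intro fin_supp_scale fin_supp_dsym)
  moreover have "lin_ext lift_pairing (\<lambda>h. b * dsym c h) = lift_pairing b c"
    using lift_pairing_add(1) by (rule lin_ext_dsym)
  ultimately show ?case using step by simp
qed

lemma kernel_Suc:
  assumes "H_minus1_vanishes \<phi> \<tau>" and "lifts (Suc n) x 0"
  shows "x = 0"
proof -
  obtain w where w: "lifts_form n x w" "contr \<tau> w = 0"
    using lifts_Suc_form[OF assms(2)] by blast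
  with assms(1) have "w \<in> amod_span (kaehler_relations \<phi> \<union> wedge2_image \<tau>)"
    unfolding H_minus1_vanishes_def using lifts_form_fin_supp by blast
  then have "fin_supp w \<and> lin_ext lift_pairing w = 0"
    by (rule lin_ext_span[rotated 5])
      (rule lift_pairing_add lift_pairing_mult lift_pairing_const lift_pairing_koszul)+
  with lin_ext_lift_pairing[OF w(1)] show ?thesis by simp
qed

end

lemma lifts_kernel:
  assumes "H_minus1_vanishes \<phi> \<tau>"
  shows "lifts n x 0 \<Longrightarrow> x = 0"
proof (induction n arbitrary: x rule: less_induct)
  case (less n)
  show ?case
  proof (cases n)
    case 0
    with less.prems show ?thesis using lifts_degree_zero[of x 0] by (simp add: J_var_zero)
  next
    case (Suc m)
    with less.prems show ?thesis
      using kernel_Suc[of m x] less.IH assms by (auto simp: less_Suc_eq_le)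
  qed
qed

theorem H_minus1_imp_iso:
  assumes "H_minus1_vanishes \<phi> \<tau>"
  shows "canonical_iso \<tau> \<phi> (Agr 0)"
proof -
  have inj: "jcong \<tau> \<phi> (Agr 0) s t" if "jwf (Agr 0) s" "jwf (Agr 0) t" "jeval \<tau> \<phi> s = jeval \<tau> \<phi> t" for s t
  proof -
    have "decomposes (J s + - J t) (jeval \<tau> \<phi> s + - jeval \<tau> \<phi> t)"
      using that(1,2) by (intro decomposes.add decomposes_minus decomposes_term)
    then have "decomposes (J s - J t) 0" by (simp add: that(3))
    from decomposes_components[OF this] obtain f g S where S: "finite S"
      and l: "\<forall>i. lifts i (f i) (g i)" and z: "\<forall>i. i \<notin> S \<longrightarrow> f i = 0 \<and> g i = 0"
      and sum: "J s - J t = sum f S" "0 = sum g S"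
      by (elim exE conjE)
    \<comment> \<open>The images of the homogeneous parts sum to \<open>0\<close>, so by
      independence of the degrees each part lies in the kernel separately.\<close>
    have "component 0 = g"
      using l z S sum(2) by (intro component_unique[of g S]) (simp_all add: lifts_Agr[OF l[rule_format]])
    then have "g i = 0" for i
      using component_homogeneous[OF Agr_zero[of 0], of i] by simp
    then have "lifts i (f i) 0" for i
      using l[rule_format, of i] by simp
    then have "f i = 0" for i by (rule lifts_kernel[OF assms])
    with sum(1) have "J s = J t" by simp
    with that(1,2) show ?thesis by (simp add: arc_eq_iff)
  qed
  show ?thesis
    unfolding canonical_iso_def
  proof (intro conjI allI impI iffI)
    show "jeval \<tau> \<phi> s = jeval \<tau> \<phi> t" if "jcong \<tau> \<phi> (Agr 0) s t" for s t
      using jcong_sound[OF that] by (rule conjunct1)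
  qed (simp_all add: inj jeval_surj)
qed

end

theorem theorem14p1:
  fixes \<phi> :: "'k::field \<Rightarrow> 'a::comm_ring_1"
    and Agr :: "nat \<Rightarrow> 'a set"
    and \<tau> :: "'a \<Rightarrow> 'a"
  assumes "is_k_algebra \<phi>"
    and "is_graded \<phi> Agr"
    and "is_k_derivation \<phi> \<tau>"
    and "degree_one Agr \<tau>"
    and "diff_generated \<phi> \<tau> (Agr 0)"
    and "finite_type \<phi> (Agr 0)"
  shows "H_minus1_vanishes \<phi> \<tau> \<longleftrightarrow> canonical_iso \<tau> \<phi> (Agr 0)"
proof -
  interpret graded_diff_algebra \<phi> \<tau> Agr
    using assms by unfold_locales
  show ?thesis
    using H_minus1_imp_iso iso_imp_H_minus1 by blast
qed

end
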